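(* Consider Case 2 of the problem described in the context (latent heat $\ell$ unknown; $k,\rho,c>0$, $T_m$, $T_0>T_m$, $q_0>0$ given), whose solution for $0<\alpha<1$, under the hypothesis $\frac{\sqrt{\rho ck}(T_0-T_m)}{q_0\Gamma(1-\alpha/2)}<1$, is $\ell_\alpha=\frac{c(T_0-T_m)\Gamma(1-\frac{\alpha}{2})}{\Gamma(1+\frac{\alpha}{2})}\frac{M_{\alpha/2}(\xi_\alpha)}{\xi_\alpha[1-W(-\xi_\alpha;-\frac{\alpha}{2},1)]}$, $T_\alpha(x,t)=T_0-\frac{T_0-T_m}{1-W(-\xi_\alpha;-\frac{\alpha}{2},1)}[1-W(-\frac{x}{\lambda t^{\alpha/2}};-\frac{\alpha}{2},1)]$, $s_\alpha(t)=\lambda\xi_\alpha t^{\alpha/2}$, $\lambda=\sqrt{k/(\rho c)}$, with $\xi_\alpha>0$ the unique solution of $1-W(-x;-\frac{\alpha}{2},1)=\frac{\sqrt{\rho ck}(T_0-T_m)}{q_0\Gamma(1-\frac{\alpha}{2})}$, $x>0$. Then, as $\alpha\to1^-$, this solution coincides with the following one (the classical case $\alpha=1$): $$s_1(t)=2\lambda\mu_1t^{1/2},\quad T_1(x,t)=T_0-q_0\sqrt{\frac{\pi}{\rho ck}}\operatorname{erf}\left(\frac{x}{2\lambda t^{1/2}}\right),$$ $$\ell_1=q_0\sqrt{\frac{c}{\rho k}}\,\frac{\exp(-\mu_1^2)}{\mu_1},\quad \lambda=\sqrt{\frac{k}{\rho c}},$$ where $\mu_1>0$ is the unique solution of $$\operatorname{erf}(x)=\frac{T_0-T_m}{q_0}\sqrt{\frac{\rho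 ck}{\pi}},\quad x>0;$$ in particular the hypothesis on the data becomes $\frac{T_0-T_m}{q_0}\sqrt{\frac{\rho ck}{\pi}}<1$.
   Context: For $0<\alpha<1$ the Caputo derivative is $D^\alpha f(t)=\frac{1}{\Gamma(1-\alpha)}\int_0^t \frac{f'(\tau)}{(t-\tau)^\alpha}d\tau$, and $D^1f=f'$. The Wright function is $W(z;a,b)=\sum_{n\ge0}\frac{z^n}{n!\,\Gamma(na+b)}$ ($a>-1$, $b\in\mathbb{R}$); the Mainardi function is $M_\nu(z)=W(-z;-\nu,1-\nu)$. $\operatorname{erf}(x)=\frac{2}{\sqrt\pi}\int_0^x e^{-u^2}du$. The problem (for $0<\alpha\le 1$): with positive constants $\rho,k,c,\ell$, $\lambda^2=k/(\rho c)$, melting temperature $T_m$, $T_0>T_m$, $q_0>0$, find $s(t)$, $T(x,t)$ and the unknown coefficient with $D^\alpha T=\lambda^2T_{xx}$ in $0<x<s(t)$, $t>0$; $s(0)=0$; $T(x,0)=T(+\infty,t)=T_m$; $T(s(t),t)=T_m$; $-kT_x(s(t),t)=\rho\ell D^\alpha s(t)$; $T(0,t)=T_0$; $kT_x(0,t)=-q_0/t^{\alpha/2}$ for $t>0$. *)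

theory Defs
  imports "HOL-Analysis.Analysis"
begin

(* Wright function W(z;a,b) = sum_{n>=0} z^n / (n! Gamma(n a + b)).
   Isabelle's Gamma is 0 at the poles, and x/0 = 0, so terms at poles
   vanish, matching the convention 1/Gamma(pole) = 0. *)
definition wright :: "real \<Rightarrow> real \<Rightarrow> real \<Rightarrow> real" where
  "wright z a b = (\<Sum>n. z ^ n / (fact n * Gamma (real n * a + b)))"

definition mainardi :: "real \<Rightarrow> real \<Rightarrow> real" where
  "mainardi \<nu> z = wright (- z) (- \<nu>) (1 - \<nu>)"

definition erf :: "real \<Rightarrow> real" where
  "erf x = 2 / sqrt pi *
     (if 0 \<le> x then integral {0..x} (\<lambda>u. exp (- u\<^sup>2))
      else - integral {x..0} (\<lambda>u. exp (- u\<^sup>2)))"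

definition lam :: "real \<Rightarrow> real \<Rightarrow> real \<Rightarrow> real" where
  "lam \<rho> k c = sqrt (k / (\<rho> * c))"

definition xi_frac :: "real \<Rightarrow> real \<Rightarrow> real \<Rightarrow> real \<Rightarrow> real \<Rightarrow> real \<Rightarrow> real \<Rightarrow> real" where
  "xi_frac \<alpha> \<rho> k c Tm T0 q0 =
     (THE x. 0 < x \<and>
        1 - wright (- x) (- \<alpha> / 2) 1 = sqrt (\<rho> * c * k) * (T0 - Tm) / (q0 * Gamma (1 - \<alpha> / 2)))"

definition ell_frac :: "real \<Rightarrow> real \<Rightarrow> real \<Rightarrow> real \<Rightarrow> real \<Rightarrow> real \<Rightarrow> real \<Rightarrow> real" where
  "ell_frac \<alpha> \<rho> k c Tm T0 q0 =
     (let \<xi> = xi_frac \<alpha> \<rho> k c Tm T0 q0 in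
       c * (T0 - Tm) * Gamma (1 - \<alpha> / 2) / Gamma (1 + \<alpha> / 2) *
       (mainardi (\<alpha> / 2) \<xi> / (\<xi> * (1 - wright (- \<xi>) (- \<alpha> / 2) 1))))"

definition T_frac :: "real \<Rightarrow> real \<Rightarrow> real \<Rightarrow> real \<Rightarrow> real \<Rightarrow> real \<Rightarrow> real \<Rightarrow> real \<Rightarrow> real \<Rightarrow> real" where
  "T_frac \<alpha> \<rho> k c Tm T0 q0 x t =
     (let \<xi> = xi_frac \<alpha> \<rho> k c Tm T0 q0 in
       T0 - (T0 - Tm) / (1 - wright (- \<xi>) (- \<alpha> / 2) 1) *
         (1 - wright (- (x / (lam \<rho> k c * t powr (\<alpha> / 2)))) (- \<alpha> / 2) 1))"

definition s_frac :: "real \<Rightarrow> real \<Rightarrow> real \<Rightarrow> real \<Rightarrow> real \<Rightarrow> real \<Rightarrow> real \<Rightarrow> real \<Rightarrow> real" where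
  "s_frac \<alpha> \<rho> k c Tm T0 q0 t = lam \<rho> k c * xi_frac \<alpha> \<rho> k c Tm T0 q0 * t powr (\<alpha> / 2)"

definition mu1 :: "real \<Rightarrow> real \<Rightarrow> real \<Rightarrow> real \<Rightarrow> real \<Rightarrow> real \<Rightarrow> real" where
  "mu1 \<rho> k c Tm T0 q0 =
     (THE x. 0 < x \<and> erf x = (T0 - Tm) / q0 * sqrt (\<rho> * c * k / pi))"

definition ell_classical :: "real \<Rightarrow> real \<Rightarrow> real \<Rightarrow> real \<Rightarrow> real \<Rightarrow> real \<Rightarrow> real" where
  "ell_classical \<rho> k c Tm T0 q0 =
     (let \<mu> = mu1 \<rho> k c Tm T0 q0 in q0 * sqrt (c / (\<rho> * k)) * exp (- \<mu>\<^sup>2) / \<mu>)"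

definition T_classical :: "real \<Rightarrow> real \<Rightarrow> real \<Rightarrow> real \<Rightarrow> real \<Rightarrow> real \<Rightarrow> real \<Rightarrow> real \<Rightarrow> real" where
  "T_classical \<rho> k c Tm T0 q0 x t =
     T0 - q0 * sqrt (pi / (\<rho> * c * k)) * erf (x / (2 * lam \<rho> k c * sqrt t))"

definition s_classical :: "real \<Rightarrow> real \<Rightarrow> real \<Rightarrow> real \<Rightarrow> real \<Rightarrow> real \<Rightarrow> real \<Rightarrow> real" where
  "s_classical \<rho> k c Tm T0 q0 t = 2 * lam \<rho> k c * mu1 \<rho> k c Tm T0 q0 * sqrt t"

end

theory Submission
  imports Defs "HOL-Probability.Distributions" "HOL-Real_Asymp.Real_Asymp"
begin

text \<open>
  Put \<open>\<nu> = \<alpha>/2\<close> and \<open>F\<^sub>\<nu>(x) = 1 - W(-x; -\<nu>, 1)\<close>, so that \<open>F\<^sub>\<nu>' = M\<^sub>\<nu>\<close>.  As \<open>\<nu>\<close> tends to \<open>1/2\<close> from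
  below, the power series converge uniformly on compact sets (Tannery), with
  \<open>F\<^sub>\<nu>(x)\<close> tending to \<open>erf(x/2)\<close> and \<open>M\<^sub>\<nu>(x)\<close> to \<open>exp(-x\<^sup>2/4)/sqrt \<pi>\<close>.  Hence on a fixed interval
  \<open>[0,R]\<close> the function \<open>F\<^sub>\<nu>\<close> is eventually strictly increasing.  To exclude solutions
  of \<open>F\<^sub>\<nu>(x) = A\<close> beyond \<open>R\<close>, uniformly in \<open>\<nu>\<close>, positivity of \<open>M\<^sub>\<nu>\<close> is not needed: the reflection
  formula and Euler's integral give \<open>|W(-x; -\<nu>, b)| \<le> \<Gamma>(1-b)/\<pi>\<close> for \<open>b < 1\<close>, and a recurrence expresses
  \<open>x\<^sup>2 M\<^sub>\<nu>(x)\<close> by two such functions.  So \<open>|M\<^sub>\<nu>(x)| \<le> C/x\<^sup>2\<close>, and \<open>F\<^sub>\<nu>(x) \<ge> F\<^sub>\<nu>(R) - C/R\<close> for \<open>x \<ge> R\<close>,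
  which stays above \<open>A < 1\<close> when \<open>R\<close> is large.  Uniqueness and convergence of the solution follow,
  and all limits are then obtained by continuity.
\<close>

section \<open>The Wright function\<close>

text \<open>\<open>rGamma\<close> is entire and vanishes at the poles of \<open>Gamma\<close>, so
  the coefficients of this power series in \<open>z\<close> are continuous in \<open>a\<close> and
  \<open>b\<close>.\<close>

lemma wright_altdef: "wright z a b = (\<Sum>n. rGamma (real n * a + b) / fact n * z ^ n)"
  unfolding wright_def by (simp add: rGamma_inverse_Gamma field_simps)

section \<open>Growth of Gamma and convergence of the series\<close>

lemma Gamma_real_convex_comb_le:
  fixes x y t :: real
  assumes "0 < x" "0 < y" "0 \<le> t" "t \<le> 1"
  shows "Gamma ((1 - t) * x + t * y) \<le> Gamma x powr (1 - t) * Gamma y powr t"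
proof -
  have pos: "0 < (1 - t) * x + t * y"
    using assms by (cases "t = 0") (auto intro: add_nonneg_pos)
  have "ln (Gamma ((1 - t) * x + t * y)) \<le> (1 - t) * ln (Gamma x) + t * ln (Gamma y)"
    using convex_onD[OF log_convex_Gamma_real, of t x y] assms by simp
  hence "exp (ln (Gamma ((1 - t) * x + t * y))) \<le> exp ((1 - t) * ln (Gamma x) + t * ln (Gamma y))"
    by simp
  moreover have "Gamma x > 0" "Gamma y > 0" "Gamma ((1 - t) * x + t * y) > 0"
    using assms pos by (auto intro: Gamma_real_pos)
  ultimately show ?thesis by (simp add: powr_def exp_add)
qed

text \<open>Log-convexity between \<open>p\<close> and \<open>p + 1\<close>, where
  \<open>Gamma (p + 1) = p * Gamma p\<close>. It bounds ratios of Gamma values whose arguments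
  differ by a fraction.\<close>

lemma Gamma_real_add_le:
  fixes p s :: real
  assumes "0 < p" "0 \<le> s" "s \<le> 1"
  shows "Gamma (p + s) \<le> p powr s * Gamma p"
proof -
  have "Gamma ((1 - s) * p + s * (p + 1)) \<le> Gamma p powr (1 - s) * Gamma (p + 1) powr s"
    by (rule Gamma_real_convex_comb_le) (use assms in auto)
  also have "Gamma (p + 1) = p * Gamma p"
    by (rule Gamma_plus1) (use assms in \<open>auto elim!: nonpos_Ints_cases\<close>)
  also have "Gamma p powr (1 - s) * (p * Gamma p) powr s = p powr s * (Gamma p powr (1 - s) * Gamma p powr s)"
    using assms Gamma_real_pos[of p] by (simp add: powr_mult)
  also have "Gamma p powr (1 - s) * Gamma p powr s = Gamma p"
    using assms Gamma_real_pos[of p] by (simp flip: powr_add)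
  finally show ?thesis by (simp add: algebra_simps)
qed

text \<open>By \<open>Gamma_real_add_le\<close> with step \<nu>, the ratio of consecutive terms is
  at most \<open>(p + n * \<nu>) powr \<nu> * \<bar>R\<bar> / (n + 1)\<close> in modulus once the
  argument is positive, and this tends to 0 because \<nu> < 1. It supplies every majorant
  below.\<close>

lemma summable_Gamma_power_series:
  fixes p \<nu> R :: real
  assumes "0 < \<nu>" "\<nu> < 1"
  shows "summable (\<lambda>n. Gamma (p + real n * \<nu>) / fact n * R ^ n)"
proof -
  have "((\<lambda>n. (p + real n * \<nu>) powr \<nu> / (real n + 1) * \<bar>R\<bar>) \<longlongrightarrow> 0) at_top"
    using assms by real_asymp
  hence "eventually (\<lambda>n. (p + real n * \<nu>) powr \<nu> / (real n + 1) * \<bar>R\<bar> < 1/2) at_top"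
    by (rule order_tendstoD) simp
  moreover have "eventually (\<lambda>n. p + real n * \<nu> > 0) at_top"
    using assms by real_asymp
  ultimately have "eventually (\<lambda>n. p + real n * \<nu> > 0 \<and>
      (p + real n * \<nu>) powr \<nu> / (real n + 1) * \<bar>R\<bar> < 1/2) at_top"
    by eventually_elim auto
  then obtain N where N: "\<And>n. n \<ge> N \<Longrightarrow> p + real n * \<nu> > 0 \<and>
      (p + real n * \<nu>) powr \<nu> / (real n + 1) * \<bar>R\<bar> < 1/2"
    by (auto simp: eventually_at_top_linorder)
  show ?thesis
  proof (rule summable_ratio_test[where c = "1/2" and N = N])
    fix n assume n: "n \<ge> N"
    define q where "q = p + real n * \<nu>"
    have q: "q > 0" "q powr \<nu> / (real n + 1) * \<bar>R\<bar> < 1/2" using N[OF n] by (auto simp: q_def)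
    have e: "p + real (Suc n) * \<nu> = q + \<nu>" by (simp add: q_def algebra_simps)
    have G: "Gamma q > 0" "Gamma (q + \<nu>) > 0" using q assms by (auto intro: Gamma_real_pos)
    have "norm (Gamma (p + real (Suc n) * \<nu>) / fact (Suc n) * R ^ Suc n)
        = Gamma (q + \<nu>) / (real n + 1) / fact n * \<bar>R\<bar> * \<bar>R\<bar> ^ n"
      using G unfolding e by (simp add: abs_mult power_abs field_simps)
    also have "\<dots> \<le> (q powr \<nu> * Gamma q) / (real n + 1) / fact n * \<bar>R\<bar> * \<bar>R\<bar> ^ n"
      by (intro mult_right_mono divide_right_mono Gamma_real_add_le) (use assms q in auto)
    also have "\<dots> = (q powr \<nu> / (real n + 1) * \<bar>R\<bar>) * (Gamma q / fact n * \<bar>R\<bar> ^ n)"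
      by simp
    also have "\<dots> \<le> 1/2 * (Gamma q / fact n * \<bar>R\<bar> ^ n)"
      by (intro mult_right_mono) (use q G in auto)
    also have "\<dots> = 1/2 * norm (Gamma (p + real n * \<nu>) / fact n * R ^ n)"
      using G by (simp add: q_def abs_mult power_abs)
    finally show "norm (Gamma (p + real (Suc n) * \<nu>) / fact (Suc n) * R ^ Suc n) \<le>
      1/2 * norm (Gamma (p + real n * \<nu>) / fact n * R ^ n)" .
  qed simp
qed

text \<open>The complex reflection formula restricted to the real line; \<open>y < 1\<close> makes
  \<open>Gamma (1 - y)\<close> positive, so that its reciprocal can be moved to the other
  side.\<close>

lemma rGamma_reflection_real:
  fixes y :: real
  assumes "y < 1"
  shows "rGamma y = Gamma (1 - y) * sin (pi * y) / pi"
proof -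
  have "complex_of_real (rGamma y * rGamma (1 - y)) = complex_of_real (sin (pi * y) / pi)"
  proof -
    have "complex_of_real (rGamma y * rGamma (1 - y)) = rGamma (of_real y) * rGamma (of_real (1 - y))"
      by (simp only: of_real_mult rGamma_complex_of_real)
    also have "of_real (1 - y) = 1 - complex_of_real y" by simp
    also have "rGamma (complex_of_real y) * rGamma (1 - complex_of_real y) =
        sin (of_real pi * of_real y) / of_real pi"
      by (rule rGamma_reflection_complex)
    also have "\<dots> = complex_of_real (sin (pi * y) / pi)" by (simp flip: sin_of_real)
    finally show ?thesis .
  qed
  hence "rGamma y * rGamma (1 - y) = sin (pi * y) / pi" by (simp only: of_real_eq_iff)
  moreover have "Gamma (1 - y) > 0" using assms by (intro Gamma_real_pos) auto
  ultimately show ?thesis by (simp add: rGamma_inverse_Gamma[of "1 - y"] field_simps)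
qed

lemma abs_rGamma_le:
  fixes y :: real
  assumes "y < 1"
  shows "\<bar>rGamma y\<bar> \<le> Gamma (1 - y) / pi"
proof -
  have "Gamma (1 - y) > 0" using assms by (intro Gamma_real_pos) auto
  moreover have "\<bar>sin (pi * y)\<bar> \<le> 1" by simp
  ultimately show ?thesis
    by (simp add: rGamma_reflection_real[OF assms] abs_mult divide_right_mono mult_left_le)
qed

lemma summable_wright:
  fixes z \<nu> b :: real
  assumes "0 < \<nu>" "\<nu> < 1"
  shows "summable (\<lambda>n. rGamma (real n * (- \<nu>) + b) / fact n * z ^ n)"
proof (rule summable_comparison_test_ev)
  show "summable (\<lambda>n. (Gamma ((1 - b) + real n * \<nu>) / fact n * \<bar>z\<bar> ^ n) / pi)"
    by (intro summable_divide summable_Gamma_power_series assms)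
  \<comment> \<open>The reflection bound applies only to arguments below 1; for large
    \<open>b\<close> the first terms lie outside its range, hence the comparison is only
    eventual.\<close>
  have "eventually (\<lambda>n. real n * (- \<nu>) + b < 1) at_top"
    using assms by real_asymp
  thus "\<forall>\<^sub>F n in sequentially. norm (rGamma (real n * (- \<nu>) + b) / fact n * z ^ n)
          \<le> (Gamma ((1 - b) + real n * \<nu>) / fact n * \<bar>z\<bar> ^ n) / pi"
  proof eventually_elim
    case (elim n)
    have "norm (rGamma (real n * (- \<nu>) + b) / fact n * z ^ n)
      = \<bar>rGamma (real n * (- \<nu>) + b)\<bar> / fact n * \<bar>z\<bar> ^ n"
      by (simp add: abs_mult power_abs)
    also have "\<dots> \<le> (Gamma (1 - (real n * (- \<nu>) + b)) / pi) / fact n * \<bar>z\<bar> ^ n"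
      by (intro mult_right_mono divide_right_mono abs_rGamma_le elim) auto
    finally show ?case by (simp add: algebra_simps)
  qed
qed

text \<open>Shifting the index by one cancels the factor \<open>n + 1\<close> against the factorial
  and lowers the second parameter by \<nu>. For \<open>b = 1\<close> this leads from W to the
  Mainardi function.\<close>

lemma DERIV_wright:
  fixes x \<nu> b :: real
  assumes "0 < \<nu>" "\<nu> < 1"
  shows "((\<lambda>z. wright z (- \<nu>) b) has_field_derivative wright x (- \<nu>) (b - \<nu>)) (at x)"
proof -
  have "diffs (\<lambda>n. rGamma (real n * (- \<nu>) + b) / fact n) =
      (\<lambda>n. rGamma (real n * (- \<nu>) + (b - \<nu>)) / fact n)"
  proof
    fix n
    have "real (Suc n) * (- \<nu>) + b = real n * (- \<nu>) + (b - \<nu>)" by (simp add: algebra_simps)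
    thus "diffs (\<lambda>n. rGamma (real n * (- \<nu>) + b) / fact n) n =
        rGamma (real n * (- \<nu>) + (b - \<nu>)) / fact n"
      unfolding diffs_def by (simp only: fact_Suc) simp
  qed
  thus ?thesis
    using termdiffs_strong_converges_everywhere[OF summable_wright[OF assms, of b], of x]
    by (simp only: wright_altdef)
qed

lemma wright_0: "wright 0 a 1 = 1"
  by (simp add: wright_def powser_zero[where f = "\<lambda>n. 1 / (fact n * Gamma (real n * a + 1))", simplified])

section \<open>A bound on the negative half-axis\<close>

text \<open>The series is the imaginary part of exp(i\<theta>) exp(-y exp(-i\<phi>)), whose modulus
  is exp(-y cos \<phi>).\<close>

lemma abs_suminf_sin_le:
  fixes y \<theta> \<phi> :: real
  assumes "0 \<le> y" "0 \<le> cos \<phi>"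
  shows "\<bar>\<Sum>n. (- y) ^ n / fact n * sin (\<theta> - real n * \<phi>)\<bar> \<le> 1"
proof -
  have "(\<lambda>n. ((- y) *\<^sub>R cis (- \<phi>)) ^ n /\<^sub>R fact n) sums exp ((- y) *\<^sub>R cis (- \<phi>))"
    by (rule exp_converges)
  hence "(\<lambda>n. cis \<theta> * (((- y) *\<^sub>R cis (- \<phi>)) ^ n /\<^sub>R fact n)) sums (cis \<theta> * exp ((- y) *\<^sub>R cis (- \<phi>)))"
    by (rule sums_mult)
  hence "(\<lambda>n. Im (cis \<theta> * (((- y) *\<^sub>R cis (- \<phi>)) ^ n /\<^sub>R fact n))) sums Im (cis \<theta> * exp ((- y) *\<^sub>R cis (- \<phi>)))"
    by (rule sums_Im)
  also have "(\<lambda>n. Im (cis \<theta> * (((- y) *\<^sub>R cis (- \<phi>)) ^ n /\<^sub>R fact n))) =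
      (\<lambda>n. (- y) ^ n / fact n * sin (\<theta> - real n * \<phi>))"
  proof
    fix n
    have "cis \<theta> * (((- y) *\<^sub>R cis (- \<phi>)) ^ n /\<^sub>R fact n) =
        ((- y) ^ n / fact n) *\<^sub>R cis (\<theta> - real n * \<phi>)"
      by (simp only: scaleR_power Complex.DeMoivre)
         (simp add: divide_inverse mult.commute cis_mult)
    thus "Im (cis \<theta> * (((- y) *\<^sub>R cis (- \<phi>)) ^ n /\<^sub>R fact n)) =
       (- y) ^ n / fact n * sin (\<theta> - real n * \<phi>)" by simp
  qed
  finally have "(\<Sum>n. (- y) ^ n / fact n * sin (\<theta> - real n * \<phi>)) =
      Im (cis \<theta> * exp ((- y) *\<^sub>R cis (- \<phi>)))" by (simp add: sums_iff)
  also have "\<bar>\<dots>\<bar> \<le> norm (cis \<theta> * exp ((- y) *\<^sub>R cis (- \<phi>)))"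
    by (rule abs_Im_le_cmod)
  also have "\<dots> = exp (- (y * cos \<phi>))" by (simp add: norm_mult)
  also have "\<dots> \<le> 1" using assms by simp
  finally show ?thesis .
qed

lemma has_bochner_integral_Gamma:
  fixes p :: real
  assumes "p > 0"
  shows "has_bochner_integral lborel (\<lambda>t. indicator {0..} t * (t powr (p - 1) / exp t)) (Gamma p)"
proof (rule has_bochner_integral_nn_integral)
  show "(\<integral>\<^sup>+ t. ennreal (indicator {0..} t * (t powr (p - 1) / exp t)) \<partial>lborel) = ennreal (Gamma p)"
    using Gamma_conv_nn_integral_real[OF assms] by simp
qed (use Gamma_real_pos[OF assms] in \<open>auto simp: indicator_def\<close>)

text \<open>
  Reflection turns \<open>1/\<Gamma>(b - n\<nu>)\<close> into \<open>\<Gamma>(1-b+n\<nu>) sin(\<pi>(b - n\<nu>))/\<pi>\<close>; inserting Euler's integral and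
  exchanging sum and integral leaves \<open>e\<^sup>-\<^sup>t t\<^sup>-\<^sup>b\<close> times the imaginary part of a number of modulus
  \<open>exp(-x t\<^sup>\<nu> cos(\<pi>\<nu>))\<close>, at most 1 since \<open>\<nu> \<le> 1/2\<close>.
\<close>
lemma abs_wright_le:
  fixes x \<nu> b :: real
  assumes "0 < \<nu>" "\<nu> \<le> 1/2" "b < 1" "0 \<le> x"
  shows "\<bar>wright (- x) (- \<nu>) b\<bar> \<le> Gamma (1 - b) / pi"
proof -
  \<comment> \<open>\<open>G p\<close> is Euler's integrand for \<open>Gamma p\<close>,
    \<open>p n\<close> the argument produced by reflection in the n-th term, and \<open>d n\<close>
    the remaining factor of that term.\<close>
  define G where "G = (\<lambda>p t. indicator {0..} t * (t powr (p - 1) / exp t) :: real)"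
  define p where "p = (\<lambda>n::nat. 1 - b + real n * \<nu>)"
  define d where "d = (\<lambda>n::nat. (- x) ^ n / fact n * (sin (pi * b - real n * (pi * \<nu>)) / pi))"
  define f where "f = (\<lambda>n t. d n * G (p n) t)"
  have p: "p n > 0" for n using assms by (simp add: p_def add_pos_nonneg)
  have G: "has_bochner_integral lborel (G (p n)) (Gamma (p n))" for n
    unfolding G_def by (rule has_bochner_integral_Gamma[OF p])
  have G0: "G (p n) t \<ge> 0" for n t by (simp add: G_def)
  have dabs: "\<bar>d n\<bar> \<le> x ^ n / fact n / pi" for n
  proof -
    have "\<bar>d n\<bar> = x ^ n / fact n / pi * \<bar>sin (pi * b - real n * (pi * \<nu>))\<bar>"
      using assms by (simp add: d_def abs_mult power_abs)
    also have "\<dots> \<le> x ^ n / fact n / pi * 1"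
      using assms by (intro mult_left_mono) auto
    finally show ?thesis by simp
  qed
  \<comment> \<open>At \<open>t = 0\<close> both sides vanish because \<open>0 powr a = 0\<close>
    for every \<open>a\<close>; for \<open>t < 0\<close> the indicator vanishes.\<close>
  have Gp: "G (p n) t = G (1 - b) t * (t powr \<nu>) ^ n" for n t
  proof (cases "t > 0")
    case True
    hence "t powr (p n - 1) = t powr (1 - b - 1) * t powr (real n * \<nu>)"
      by (simp add: p_def add_ac flip: powr_add)
    also have "t powr (real n * \<nu>) = (t powr \<nu>) ^ n"
      using True by (simp add: powr_powr powr_power mult.commute)
    finally show ?thesis by (simp add: G_def)
  qed (auto simp: G_def indicator_def)
  have term_eq: "rGamma (real n * (- \<nu>) + b) / fact n * (- x) ^ n = integral\<^sup>L lborel (f n)" for n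
  proof -
    have "rGamma (real n * (- \<nu>) + b) = Gamma (p n) * sin (pi * (real n * (- \<nu>) + b)) / pi"
      using p[of n] by (subst rGamma_reflection_real) (auto simp: p_def algebra_simps)
    also have "pi * (real n * (- \<nu>) + b) = pi * b - real n * (pi * \<nu>)" by (simp add: algebra_simps)
    finally have "rGamma (real n * (- \<nu>) + b) / fact n * (- x) ^ n = d n * Gamma (p n)"
      by (simp only: d_def mult_ac times_divide_eq_left times_divide_eq_right divide_divide_eq_left)
    also have "Gamma (p n) = integral\<^sup>L lborel (G (p n))"
      using G[of n] by (simp add: has_bochner_integral_integral_eq)
    finally show ?thesis by (simp add: f_def)
  qed
  have int: "integrable lborel (f n)" for n
    using G[of n] unfolding f_def by (intro integrable_mult_right) (rule integrable.intros)
  have nrm: "norm (f n t) \<le> G (1 - b) t / pi * ((x * t powr \<nu>) ^ n / fact n)" for n t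
  proof -
    have "norm (f n t) = \<bar>d n\<bar> * G (p n) t" using G0[of n t] by (simp add: f_def abs_mult)
    also have "\<dots> \<le> x ^ n / fact n / pi * G (p n) t" by (intro mult_right_mono dabs G0)
    finally show ?thesis unfolding Gp by (simp add: power_mult_distrib mult_ac)
  qed
  have summ: "summable (\<lambda>n. norm (f n t))" for t
  proof (rule summable_comparison_test')
    show "summable (\<lambda>n. G (1 - b) t / pi * ((x * t powr \<nu>) ^ n / fact n))"
      using summable_exp[of "x * t powr \<nu>"] by (intro summable_mult) (simp add: field_simps)
    show "norm (norm (f n t)) \<le> G (1 - b) t / pi * ((x * t powr \<nu>) ^ n / fact n)" if "n \<ge> 0" for n
      using nrm by simp
  qed
  \<comment> \<open>Absolute convergence after integration, which together with \<open>summ\<close>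
    permits the exchange of sum and integral.\<close>
  have summI: "summable (\<lambda>n. \<integral>t. norm (f n t) \<partial>lborel)"
  proof (rule summable_comparison_test')
    show "summable (\<lambda>n. (Gamma (1 - b + real n * \<nu>) / fact n * x ^ n) / pi)"
      by (intro summable_divide summable_Gamma_power_series) (use assms in auto)
    fix n :: nat
    have "(\<integral>t. norm (f n t) \<partial>lborel) = (\<integral>t. \<bar>d n\<bar> * G (p n) t \<partial>lborel)"
      using G0 by (simp add: f_def abs_mult)
    also have "\<dots> = \<bar>d n\<bar> * Gamma (p n)"
      using G[of n] by (simp add: has_bochner_integral_integral_eq)
    also have "\<dots> \<le> x ^ n / fact n / pi * Gamma (p n)"
      using Gamma_real_pos[OF p[of n]] by (intro mult_right_mono dabs) auto
    finally show "norm (\<integral>t. norm (f n t) \<partial>lborel) \<le> (Gamma (1 - b + real n * \<nu>) / fact n * x ^ n) / pi"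
      by (simp add: p_def mult_ac)
  qed
  have bound: "\<bar>\<Sum>n. f n t\<bar> \<le> G (1 - b) t / pi" for t
  proof -
    have eq: "f n t = G (1 - b) t / pi * ((- (x * t powr \<nu>)) ^ n / fact n * sin (pi * b - real n * (pi * \<nu>)))" for n
    proof -
      have "(- (x * t powr \<nu>)) ^ n = (- x) ^ n * (t powr \<nu>) ^ n" by (simp flip: power_mult_distrib)
      thus ?thesis
        by (simp only: f_def d_def Gp mult_ac times_divide_eq_left times_divide_eq_right divide_divide_eq_left)
    qed
    have "summable (\<lambda>n. (- (x * t powr \<nu>)) ^ n / fact n * sin (pi * b - real n * (pi * \<nu>)))"
    proof (rule summable_comparison_test')
      show "summable (\<lambda>n. (x * t powr \<nu>) ^ n / fact n)"
        using summable_exp[of "x * t powr \<nu>"] by (simp add: field_simps)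
      fix n :: nat
      have "norm ((- (x * t powr \<nu>)) ^ n / fact n * sin (pi * b - real n * (pi * \<nu>)))
          = (x * t powr \<nu>) ^ n / fact n * \<bar>sin (pi * b - real n * (pi * \<nu>))\<bar>"
        using assms by (simp add: abs_mult power_abs)
      also have "\<dots> \<le> (x * t powr \<nu>) ^ n / fact n * 1"
        using assms by (intro mult_left_mono) auto
      finally show "norm ((- (x * t powr \<nu>)) ^ n / fact n * sin (pi * b - real n * (pi * \<nu>)))
          \<le> (x * t powr \<nu>) ^ n / fact n" by simp
    qed
    hence sum_eq: "(\<Sum>n. f n t) = G (1 - b) t / pi *
        (\<Sum>n. (- (x * t powr \<nu>)) ^ n / fact n * sin (pi * b - real n * (pi * \<nu>)))"
      unfolding eq by (rule suminf_mult)
    have "pi * \<nu> \<le> pi * (1/2)" by (rule mult_left_mono) (use assms in simp_all)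
    moreover have "0 \<le> pi * \<nu>" using assms by simp
    ultimately have "0 \<le> cos (pi * \<nu>)" by (intro cos_ge_zero) linarith+
    moreover have "0 \<le> x * t powr \<nu>" using assms by simp
    ultimately have "\<bar>\<Sum>n. (- (x * t powr \<nu>)) ^ n / fact n * sin (pi * b - real n * (pi * \<nu>))\<bar> \<le> 1"
      by (intro abs_suminf_sin_le)
    moreover have nn: "0 \<le> G (1 - b) t / pi" using G0[of 0 t] by (simp add: p_def)
    ultimately have "G (1 - b) t / pi * \<bar>\<Sum>n. (- (x * t powr \<nu>)) ^ n / fact n * sin (pi * b - real n * (pi * \<nu>))\<bar>
        \<le> G (1 - b) t / pi" by (intro mult_left_le)
    thus ?thesis unfolding sum_eq abs_mult abs_of_nonneg[OF nn] .
  qed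
  have "wright (- x) (- \<nu>) b = (\<Sum>n. integral\<^sup>L lborel (f n))"
    unfolding wright_altdef term_eq ..
  also have "\<dots> = (\<integral>t. (\<Sum>n. f n t) \<partial>lborel)"
    by (rule integral_suminf[symmetric]) (use int summ summI in auto)
  also have "\<bar>\<dots>\<bar> \<le> (\<integral>t. G (1 - b) t / pi \<partial>lborel)"
  proof (rule integral_abs_bound[THEN order_trans], rule integral_mono)
    show "integrable lborel (\<lambda>t. G (1 - b) t / pi)"
      using G[of 0] by (intro integrable_divide) (auto simp: p_def integrable.simps)
    show "integrable lborel (\<lambda>t. \<bar>\<Sum>n. f n t\<bar>)"
      by (intro integrable_abs integrable_suminf) (use int summ summI in auto)
  qed (rule bound)
  also have "\<dots> = Gamma (1 - b) / pi"
    using G[of 0] by (simp add: has_bochner_integral_integral_eq p_def)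
  finally show ?thesis .
qed

section \<open>Quadratic decay of the Mainardi function\<close>

text \<open>Both Wright functions on the right have second parameter below 1 for \<nu> < 1, so
  \<open>abs_wright_le\<close> bounds them independently of the argument once \<nu> \<le>
  1/2.\<close>

lemma power2_mult_wright:
  fixes z \<nu> :: real
  assumes "0 < \<nu>" "\<nu> < 1"
  shows "z\<^sup>2 * wright z (- \<nu>) (1 - \<nu>) =
    (1 / \<nu>\<^sup>2 - 1 / \<nu>) * wright z (- \<nu>) \<nu> + 1 / \<nu>\<^sup>2 * wright z (- \<nu>) (\<nu> - 1)"
proof -
  \<comment> \<open>The m-th term of the series of the left-hand side after the shift m = n + 2; the
    factor \<open>m * (m - 1)\<close> turns \<open>1 / fact (m - 2)\<close> into
    \<open>1 / fact m\<close> and makes the terms with m = 0, 1 vanish.\<close>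
  define g where "g = (\<lambda>m. real m * (real m - 1) * rGamma (real m * (- \<nu>) + (1 + \<nu>)) / fact m * z ^ m)"
  have g_eq: "g m = (1 / \<nu>\<^sup>2 - 1 / \<nu>) * (rGamma (real m * (- \<nu>) + \<nu>) / fact m * z ^ m)
      + 1 / \<nu>\<^sup>2 * (rGamma (real m * (- \<nu>) + (\<nu> - 1)) / fact m * z ^ m)" for m
  proof -
    \<comment> \<open>In terms of \<open>y\<close> the factor \<open>m * (m - 1)\<close> is the
      quadratic \<open>y^2 / \<nu>^2 - y / \<nu>\<close>, and two uses of
      \<open>z * rGamma (z + 1) = rGamma z\<close> absorb its powers of \<open>y\<close>.\<close>
    define y where "y = real m * (- \<nu>) + \<nu>"
    have m: "real m = 1 - y / \<nu>" using assms by (simp add: y_def field_simps)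
    have r1: "rGamma y = y * rGamma (y + 1)" by (simp add: rGamma_plus1)
    have r2: "rGamma (y - 1) = (y - 1) * rGamma y" using rGamma_plus1[of "y - 1"] by simp
    have "real m * (real m - 1) * rGamma (y + 1) =
        (1 / \<nu>\<^sup>2 - 1 / \<nu>) * rGamma y + 1 / \<nu>\<^sup>2 * rGamma (y - 1)"
      unfolding r2 r1 m using assms by (simp add: field_simps power2_eq_square)
    moreover have "real m * (- \<nu>) + (1 + \<nu>) = y + 1" "real m * (- \<nu>) + (\<nu> - 1) = y - 1"
      by (simp_all add: y_def)
    ultimately have "g m = ((1 / \<nu>\<^sup>2 - 1 / \<nu>) * rGamma y + 1 / \<nu>\<^sup>2 * rGamma (y - 1)) / fact m * z ^ m"
      by (simp only: g_def)
    also have "\<dots> = (1 / \<nu>\<^sup>2 - 1 / \<nu>) * (rGamma y / fact m * z ^ m)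
      + 1 / \<nu>\<^sup>2 * (rGamma (y - 1) / fact m * z ^ m)" by (simp add: ring_distribs add_divide_distrib)
    finally show ?thesis by (simp add: y_def add_diff_eq)
  qed
  have "(\<lambda>m. g m) sums ((1 / \<nu>\<^sup>2 - 1 / \<nu>) * wright z (- \<nu>) \<nu> + 1 / \<nu>\<^sup>2 * wright z (- \<nu>) (\<nu> - 1))"
    unfolding g_eq wright_altdef
    by (intro sums_add sums_mult summable_sums summable_wright assms)
  moreover have "g 0 = 0" "g 1 = 0" by (simp_all add: g_def)
  ultimately have "(\<lambda>m. g (m + 2)) sums ((1 / \<nu>\<^sup>2 - 1 / \<nu>) * wright z (- \<nu>) \<nu> + 1 / \<nu>\<^sup>2 * wright z (- \<nu>) (\<nu> - 1))"
    by (subst sums_iff_shift) (simp add: numeral_2_eq_2)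
  moreover have "g (m + 2) = z\<^sup>2 * (rGamma (real m * (- \<nu>) + (1 - \<nu>)) / fact m * z ^ m)" for m
  proof -
    have "real (m + 2) * (- \<nu>) + (1 + \<nu>) = real m * (- \<nu>) + (1 - \<nu>)" by (simp add: algebra_simps)
    moreover have "fact (m + 2) = real (m + 2) * (real (m + 2) - 1) * fact m"
      by (simp add: algebra_simps)
    ultimately have "g (m + 2) = real (m + 2) * (real (m + 2) - 1) * rGamma (real m * (- \<nu>) + (1 - \<nu>)) /
        (real (m + 2) * (real (m + 2) - 1) * fact m) * z ^ (m + 2)"
      by (simp only: g_def)
    thus ?thesis by (simp add: power2_eq_square)
  qed
  moreover have "(\<lambda>m. z\<^sup>2 * (rGamma (real m * (- \<nu>) + (1 - \<nu>)) / fact m * z ^ m))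
      sums (z\<^sup>2 * wright z (- \<nu>) (1 - \<nu>))"
    unfolding wright_altdef by (intro sums_mult summable_sums summable_wright assms)
  ultimately show ?thesis by (simp add: sums_unique2)
qed

lemma power2_mult_abs_wright_le:
  fixes x \<nu> :: real
  assumes "0 < \<nu>" "\<nu> \<le> 1/2" "0 \<le> x"
  shows "x\<^sup>2 * \<bar>wright (- x) (- \<nu>) (1 - \<nu>)\<bar> \<le>
    (1 / \<nu>\<^sup>2 - 1 / \<nu>) * (Gamma (1 - \<nu>) / pi) + 1 / \<nu>\<^sup>2 * (Gamma (2 - \<nu>) / pi)"
proof -
  have c: "0 \<le> 1 / \<nu>\<^sup>2 - 1 / \<nu>" using assms by (simp add: field_simps power2_eq_square)
  have "x\<^sup>2 * \<bar>wright (- x) (- \<nu>) (1 - \<nu>)\<bar> = \<bar>(- x)\<^sup>2 * wright (- x) (- \<nu>) (1 - \<nu>)\<bar>"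
    by (simp add: abs_mult)
  also have "\<dots> = \<bar>(1 / \<nu>\<^sup>2 - 1 / \<nu>) * wright (- x) (- \<nu>) \<nu> + 1 / \<nu>\<^sup>2 * wright (- x) (- \<nu>) (\<nu> - 1)\<bar>"
    using assms by (subst power2_mult_wright) auto
  also have "\<dots> \<le> (1 / \<nu>\<^sup>2 - 1 / \<nu>) * \<bar>wright (- x) (- \<nu>) \<nu>\<bar> + 1 / \<nu>\<^sup>2 * \<bar>wright (- x) (- \<nu>) (\<nu> - 1)\<bar>"
    using c by (intro order_trans[OF abs_triangle_ineq]) (simp add: abs_mult)
  also have "\<dots> \<le> (1 / \<nu>\<^sup>2 - 1 / \<nu>) * (Gamma (1 - \<nu>) / pi) + 1 / \<nu>\<^sup>2 * (Gamma (1 - (\<nu> - 1)) / pi)"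
    by (intro add_mono mult_left_mono abs_wright_le c) (use assms in auto)
  finally show ?thesis by simp
qed

section \<open>The limit of order one half\<close>

text \<open>On \<open>{- R..R}\<close> the difference of the two sums is at most
  \<open>D \<nu>\<close>, the series of coefficient differences at radius \<open>R\<close>. Its
  terms are dominated by \<open>2 * (K n * R ^ n)\<close>, so Tannery's theorem sends it to
  0.\<close>

lemma power_series_uniform_limit:
  fixes a :: "'b \<Rightarrow> nat \<Rightarrow> real" and a0 K :: "nat \<Rightarrow> real" and R :: real
  assumes lim: "\<And>n. ((\<lambda>\<nu>. a \<nu> n) \<longlongrightarrow> a0 n) F"
    and bound: "\<forall>\<^sub>F \<nu> in F. \<forall>n. \<bar>a \<nu> n\<bar> \<le> K n"
    and K: "summable (\<lambda>n. K n * R ^ n)" and R: "0 \<le> R" and F: "F \<noteq> bot"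
  shows "uniform_limit {- R..R} (\<lambda>\<nu> x. \<Sum>n. a \<nu> n * x ^ n) (\<lambda>x. \<Sum>n. a0 n * x ^ n) F"
proof -
  have bound0: "\<bar>a0 n\<bar> \<le> K n" for n
  proof (rule tendsto_upperbound[OF tendsto_rabs[OF lim]])
    show "\<forall>\<^sub>F \<nu> in F. \<bar>a \<nu> n\<bar> \<le> K n" using bound by eventually_elim auto
  qed (rule F)
  define D where "D = (\<lambda>\<nu>. \<Sum>n. \<bar>a \<nu> n - a0 n\<bar> * R ^ n)"
  have dle: "norm (\<bar>a \<nu> n - a0 n\<bar> * R ^ n) \<le> 2 * (K n * R ^ n)" if "\<forall>n. \<bar>a \<nu> n\<bar> \<le> K n" for \<nu> n
  proof -
    have "\<bar>a \<nu> n - a0 n\<bar> \<le> 2 * K n"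
      using that bound0[of n] by (smt (verit, best))
    thus ?thesis using R by (simp add: mult_right_mono abs_mult flip: mult.assoc)
  qed
  have K2: "summable (\<lambda>n. 2 * (K n * R ^ n))" by (intro summable_mult K)
  have "(D \<longlongrightarrow> (\<Sum>n::nat. 0)) F"
    unfolding D_def
  proof (intro tannerys_theorem[THEN conjunct2, THEN conjunct2])
    show "((\<lambda>\<nu>. \<bar>a \<nu> n - a0 n\<bar> * R ^ n) \<longlongrightarrow> 0) F" for n
      using tendsto_mult[OF tendsto_rabs[OF tendsto_diff[OF lim[of n] tendsto_const[of "a0 n"]]] tendsto_const[of "R ^ n"]]
      by simp
    show "\<forall>\<^sub>F (n, \<nu>) in sequentially \<times>\<^sub>F F. norm (\<bar>a \<nu> n - a0 n\<bar> * R ^ n) \<le> 2 * (K n * R ^ n)"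
      unfolding case_prod_unfold
      by (rule eventually_mono[OF eventually_prodI[OF always_eventually[OF allI[OF TrueI]] bound]]) (rule dle, blast)
  qed (use K2 F in auto)
  hence D0: "(D \<longlongrightarrow> 0) F" by simp
  show ?thesis
  proof (rule uniform_limitI)
    fix e :: real assume "0 < e"
    hence "\<forall>\<^sub>F \<nu> in F. D \<nu> < e" by (rule order_tendstoD[OF D0])
    with bound show "\<forall>\<^sub>F \<nu> in F. \<forall>x\<in>{- R..R}. dist (\<Sum>n. a \<nu> n * x ^ n) (\<Sum>n. a0 n * x ^ n) < e"
    proof eventually_elim
      case (elim \<nu>)
      show ?case
      proof
        fix x assume x: "x \<in> {- R..R}"
        have xR: "\<bar>x\<bar> ^ n \<le> R ^ n" for n using x by (intro power_mono) auto
        have K0: "0 \<le> K n" for n using bound0[of n] by linarith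
        have s: "summable (\<lambda>n. c n * x ^ n)" if "\<And>n. \<bar>c n\<bar> \<le> K n" for c
          by (rule summable_comparison_test'[OF K, of 0])
             (auto simp: abs_mult power_abs intro!: mult_mono that xR K0)
        have d: "summable (\<lambda>n. \<bar>a \<nu> n - a0 n\<bar> * R ^ n)"
          by (rule summable_comparison_test'[OF K2, of 0]) (use dle elim in auto)
        have "(\<Sum>n. a \<nu> n * x ^ n) - (\<Sum>n. a0 n * x ^ n) = (\<Sum>n. (a \<nu> n - a0 n) * x ^ n)"
          using suminf_diff[OF s s, of "a \<nu>" a0] elim bound0 by (simp add: left_diff_distrib)
        also have "norm \<dots> \<le> D \<nu>"
          unfolding D_def
          by (rule norm_suminf_le[OF _ d]) (auto simp: abs_mult power_abs intro!: mult_left_mono xR)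
        finally show "dist (\<Sum>n. a \<nu> n * x ^ n) (\<Sum>n. a0 n * x ^ n) < e"
          using elim by (simp add: dist_norm)
      qed
    qed
  qed
qed

text \<open>The case \<open>j = 0\<close> serves 1 - W and \<open>j = 1\<close> serves its
  derivative, the Mainardi function.\<close>

lemma uniform_limit_wright:
  fixes R :: real and j :: nat
  assumes R: "0 \<le> R"
  shows "uniform_limit {- R..R} (\<lambda>\<nu> z. wright z (- \<nu>) (1 - real j * \<nu>))
    (\<lambda>z. wright z (- (1/2)) (1 - real j * (1/2))) (at_left (1/2))"
proof -
  \<comment> \<open>For \<nu> between 1/4 and 1/2, log-convexity bounds
    \<open>Gamma (m * \<nu>)\<close> by the sum of its values at the two ends, with
    \<open>m = n + j\<close>. The summand 1 covers \<open>m = 0\<close>, where the coefficient is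
    \<open>rGamma 1 = 1\<close>.\<close>
  define K where "K = (\<lambda>n. (1 + (Gamma (real (n + j) * (1/4)) + Gamma (real (n + j) * (1/2))) / pi) / fact n)"
  have "\<forall>\<^sub>F \<nu> in at_left (1/2). \<nu> \<in> {1/4<..<1/2::real}"
    by (rule eventually_at_left_real) simp
  hence bnd: "\<forall>\<^sub>F \<nu> in at_left (1/2). \<forall>n. \<bar>rGamma (real n * (- \<nu>) + (1 - real j * \<nu>)) / fact n\<bar> \<le> K n"
  proof eventually_elim
    case (elim \<nu>)
    have "\<bar>rGamma (1 - real m * \<nu>)\<bar> \<le> 1 + (Gamma (real m * (1/4)) + Gamma (real m * (1/2))) / pi" for m
    proof (cases "m = 0")
      case False
      hence g: "Gamma (real m * (1/4)) > 0" "Gamma (real m * (1/2)) > 0" by (auto intro!: Gamma_real_pos)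
      \<comment> \<open>The weight that writes \<nu> as
        \<open>(1 - t) * (1/4) + t * (1/2)\<close>.\<close>
      define t where "t = 4 * \<nu> - 1"
      have t: "0 \<le> t" "t \<le> 1" using elim by (auto simp: t_def)
      define B where "B = Gamma (real m * (1/4)) + Gamma (real m * (1/2))"
      have "Gamma ((1 - t) * (real m * (1/4)) + t * (real m * (1/2)))
          \<le> Gamma (real m * (1/4)) powr (1 - t) * Gamma (real m * (1/2)) powr t"
        using False t by (intro Gamma_real_convex_comb_le) auto
      also have "\<dots> \<le> B powr (1 - t) * B powr t"
        using g t by (intro mult_mono powr_mono2) (auto simp: B_def)
      also have "\<dots> = B" using g by (simp add: B_def flip: powr_add)
      also have "(1 - t) * (real m * (1/4)) + t * (real m * (1/2)) = real m * \<nu>"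
        by (simp add: t_def field_simps)
      finally have "Gamma (real m * \<nu>) / pi \<le> B / pi" by (intro divide_right_mono) auto
      moreover have "\<bar>rGamma (1 - real m * \<nu>)\<bar> \<le> Gamma (1 - (1 - real m * \<nu>)) / pi"
        using False elim by (intro abs_rGamma_le) auto
      ultimately show ?thesis by (simp add: B_def)
    qed (simp add: rGamma_inverse_Gamma)
    moreover have "real n * (- \<nu>) + (1 - real j * \<nu>) = 1 - real (n + j) * \<nu>" for n
      by (simp add: algebra_simps)
    ultimately have "\<bar>rGamma (real n * (- \<nu>) + (1 - real j * \<nu>))\<bar> / fact n \<le> K n" for n
      unfolding K_def by (intro divide_right_mono) (simp only:, simp)
    thus ?case by (simp add: abs_divide)
  qed
  have "summable (\<lambda>n. R ^ n / fact n + (Gamma (real j * (1/4) + real n * (1/4)) / fact n * R ^ n +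
      Gamma (real j * (1/2) + real n * (1/2)) / fact n * R ^ n) / pi)"
    using summable_exp[of R]
    by (intro summable_add summable_divide summable_Gamma_power_series) (auto simp: field_simps)
  also have "(\<lambda>n. R ^ n / fact n + (Gamma (real j * (1/4) + real n * (1/4)) / fact n * R ^ n +
      Gamma (real j * (1/2) + real n * (1/2)) / fact n * R ^ n) / pi) = (\<lambda>n. K n * R ^ n)"
    by (simp add: K_def fun_eq_iff ring_distribs add_divide_distrib add_ac mult_ac)
  finally have K: "summable (\<lambda>n. K n * R ^ n)" .
  show ?thesis
    unfolding wright_altdef
  proof (rule power_series_uniform_limit[OF _ bnd K R])
    fix n
    have "isCont (\<lambda>\<nu>::real. rGamma (real n * (- \<nu>) + (1 - real j * \<nu>)) / fact n) (1/2)"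
      by (intro continuous_intros) auto
    thus "((\<lambda>\<nu>. rGamma (real n * (- \<nu>) + (1 - real j * \<nu>)) / fact n) \<longlongrightarrow>
        rGamma (real n * (- (1/2)) + (1 - real j * (1/2))) / fact n) (at_left (1/2))"
      unfolding isCont_def filterlim_at_split by (rule conjunct1)
  qed simp
qed

text \<open>Uniform convergence on a neighbourhood of \<open>z0\<close> and continuity of the limit
  allow the argument to vary along with \<nu>, as the solution of the transcendental equation
  does.\<close>

lemma tendsto_wright:
  fixes z :: "'b \<Rightarrow> real" and j :: nat
  assumes \<nu>: "filterlim \<nu> (at_left (1/2)) F" and z: "(z \<longlongrightarrow> z0) F"
  shows "((\<lambda>i. wright (z i) (- \<nu> i) (1 - real j * \<nu> i)) \<longlongrightarrow> wright z0 (- (1/2)) (1 - real j * (1/2))) F"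
proof -
  define R where "R = \<bar>z0\<bar> + 1"
  define h where "h = (\<lambda>z. wright z (- (1/2)) (1 - real j * (1/2)))"
  have "uniform_limit {- R..R} (\<lambda>\<nu> z. wright z (- \<nu>) (1 - real j * \<nu>)) h (at_left (1/2))"
    unfolding h_def by (rule uniform_limit_wright) (simp add: R_def)
  hence ul: "uniform_limit {- R..R} (\<lambda>i z. wright z (- \<nu> i) (1 - real j * \<nu> i)) h F"
    by (rule filterlim_compose) (rule \<nu>)
  have "isCont h z0" unfolding h_def
    by (rule DERIV_isCont[OF DERIV_wright]) auto
  hence lim: "((\<lambda>i. h (z i)) \<longlongrightarrow> h z0) F" by (rule isCont_tendsto_compose) (rule z)
  have "((\<lambda>i. wright (z i) (- \<nu> i) (1 - real j * \<nu> i) - h (z i)) \<longlongrightarrow> 0) F"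
  proof (rule tendstoI)
    fix e :: real assume "0 < e"
    have "\<forall>\<^sub>F i in F. dist (z i) z0 < 1" using z by (rule tendstoD) simp
    with uniform_limitD[OF ul \<open>0 < e\<close>]
    show "\<forall>\<^sub>F i in F. dist (wright (z i) (- \<nu> i) (1 - real j * \<nu> i) - h (z i)) 0 < e"
    proof eventually_elim
      case (elim i)
      hence "z i \<in> {- R..R}" by (auto simp: R_def dist_real_def)
      with elim(1) show ?case by (auto simp: dist_real_def)
    qed
  qed
  from tendsto_add[OF this lim] show ?thesis by (simp add: h_def)
qed

section \<open>Closed form at \<nu> = 1/2 and the error function\<close>

lemma rGamma_one_half_minus:
  "rGamma (1/2 - real m) = (- 1) ^ m * fact (2 * m) / (4 ^ m * fact m * sqrt pi)"
proof (induction m)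
  case (Suc m)
  have "rGamma (1/2 - real (Suc m)) = (- 1/2 - real m) * rGamma (1/2 - real m)"
    using rGamma_plus1[of "1/2 - real (Suc m)"] by simp
  also have "\<dots> = (- 1) ^ Suc m * fact (2 * Suc m) / (4 ^ Suc m * fact (Suc m) * sqrt pi)"
    unfolding Suc.IH by (simp add: divide_simps) (simp add: algebra_simps)
  finally show ?case .
qed (simp add: rGamma_inverse_Gamma Gamma_one_half_real inverse_eq_divide)

text \<open>Odd terms vanish because \<open>1/2 - n/2\<close> is then a nonpositive integer. In the
  even terms \<open>fact (2 * m)\<close> cancels and the exponential series in
  \<open>- z^2 / 4\<close> remains.\<close>

lemma wright_half_half: "wright z (- (1/2)) (1/2) = exp (- z\<^sup>2 / 4) / sqrt pi"
proof -
  define f where "f = (\<lambda>n. rGamma (real n * (- (1/2)) + 1/2) / fact n * z ^ n)"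
  have odd: "f n = 0" if "n \<notin> range ((*) 2)" for n
  proof -
    have "odd n" using that by (auto elim!: evenE)
    then obtain m where "n = 2 * m + 1" by (auto elim!: oddE)
    hence "real n * (- (1/2)) + 1/2 = - of_nat m" by (simp add: field_simps)
    moreover have "rGamma (- of_nat m :: real) = 0" by (simp add: rGamma_eq_zero_iff)
    ultimately show ?thesis by (simp add: f_def)
  qed
  have "(\<lambda>m. (- z\<^sup>2 / 4) ^ m /\<^sub>R fact m / sqrt pi) sums (exp (- z\<^sup>2 / 4) / sqrt pi)"
    by (intro sums_divide exp_converges)
  also have "(\<lambda>m. (- z\<^sup>2 / 4) ^ m /\<^sub>R fact m / sqrt pi) = (\<lambda>m. f (2 * m))"
  proof
    fix m
    have "real (2 * m) * (- (1/2)) + 1/2 = 1/2 - real m" by simp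
    hence "f (2 * m) = (- 1) ^ m * fact (2 * m) / (4 ^ m * fact m * sqrt pi) / fact (2 * m) * z ^ (2 * m)"
      unfolding f_def by (simp only: rGamma_one_half_minus)
    moreover have "(- z\<^sup>2 / 4) ^ m = (- 1) ^ m * z ^ (2 * m) / 4 ^ m"
    proof -
      have "- z\<^sup>2 / 4 = (- 1) * z\<^sup>2 / 4" by simp
      thus ?thesis by (simp only: power_divide power_mult_distrib power_mult)
    qed
    ultimately show "(- z\<^sup>2 / 4) ^ m /\<^sub>R fact m / sqrt pi = f (2 * m)"
      by (simp only:) (simp add: field_simps)
  qed
  finally have "f sums (exp (- z\<^sup>2 / 4) / sqrt pi)"
    using sums_mono_reindex[of "(*) 2" f] odd by (simp add: strict_mono_def)
  thus ?thesis by (simp add: wright_altdef f_def sums_iff)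
qed

lemma DERIV_wright_half:
  "((\<lambda>u. 1 - wright (- (2 * u)) (- (1/2)) 1) has_field_derivative
    2 / sqrt pi * exp (- u\<^sup>2)) (at u within S)"
  by (rule derivative_eq_intros DERIV_chain2[OF DERIV_wright] refl
      | simp add: wright_half_half power_mult_distrib)+

text \<open>Both sides vanish at 0 and have the same derivative, since the argument
  \<open>2 * u\<close> turns exp(-z^2/4) into exp(-u^2). Thus \<open>erf\<close> is the member of
  order 1/2 of the family.\<close>

lemma erf_eq_wright:
  assumes "0 \<le> x"
  shows "erf x = 1 - wright (- (2 * x)) (- (1/2)) 1"
proof -
  have "((\<lambda>u. 2 / sqrt pi * exp (- u\<^sup>2)) has_integral
      (1 - wright (- (2 * x)) (- (1/2)) 1) - (1 - wright (- (2 * 0)) (- (1/2)) 1)) {0..x}"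
    using DERIV_wright_half
    by (intro fundamental_theorem_of_calculus[OF assms])
       (simp add: has_real_derivative_iff_has_vector_derivative)
  hence "integral {0..x} (\<lambda>u. 2 / sqrt pi * exp (- u\<^sup>2)) = 1 - wright (- (2 * x)) (- (1/2)) 1"
    unfolding mult_zero_right minus_zero wright_0 diff_self diff_zero by (rule integral_unique)
  moreover have "integral {0..x} (\<lambda>u. 2 / sqrt pi * exp (- u\<^sup>2)) =
      2 / sqrt pi * integral {0..x} (\<lambda>u. exp (- u\<^sup>2))"
    by (rule integral_mult_right)
  ultimately show ?thesis using assms by (simp add: erf_def)
qed

lemma erf_strict_mono:
  assumes "0 \<le> x" "x < y"
  shows "erf x < erf y"
proof -
  have "1 - wright (- (2 * x)) (- (1/2)) 1 < 1 - wright (- (2 * y)) (- (1/2)) 1"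
    by (rule DERIV_pos_imp_increasing[OF assms(2)]) (use DERIV_wright_half in force)
  thus ?thesis using assms by (simp add: erf_eq_wright)
qed

text \<open>The normalised Gaussian integral over the half-line, written as a limit of truncated
  integrals.\<close>

lemma erf_at_top: "(erf \<longlongrightarrow> 1) at_top"
proof -
  let ?g = "\<lambda>x::real. indicator {0..} x *\<^sub>R exp (- x\<^sup>2)"
  have "((\<lambda>b. \<integral>x. indicator {..b} x *\<^sub>R ?g x \<partial>lborel) \<longlongrightarrow> (\<integral>x. ?g x \<partial>lborel)) at_top"
    using gaussian_moment_0 by (intro tendsto_integral_at_top) (auto simp: integrable.simps)
  also have "(\<integral>x. ?g x \<partial>lborel) = sqrt pi / 2"
    using gaussian_moment_0 by (rule has_bochner_integral_integral_eq)
  finally have "((\<lambda>b. 2 / sqrt pi * (\<integral>x. indicator {..b} x *\<^sub>R ?g x \<partial>lborel)) \<longlongrightarrow> 2 / sqrt pi * (sqrt pi / 2)) at_top"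
    by (intro tendsto_intros)
  hence "((\<lambda>b. 2 / sqrt pi * (\<integral>x. indicator {..b} x *\<^sub>R ?g x \<partial>lborel)) \<longlongrightarrow> 1) at_top"
    by simp
  moreover have "\<forall>\<^sub>F b in at_top. 2 / sqrt pi * (\<integral>x. indicator {..b} x *\<^sub>R ?g x \<partial>lborel) = erf b"
    using eventually_ge_at_top[of 0]
  proof eventually_elim
    case (elim b)
    have "(\<lambda>x. indicator {..b} x *\<^sub>R ?g x) = (\<lambda>x. indicator {0..b} x *\<^sub>R exp (- x\<^sup>2))"
      by (auto simp: fun_eq_iff indicator_def)
    hence "(\<integral>x. indicator {..b} x *\<^sub>R ?g x \<partial>lborel) = (LINT x:{0..b}|lborel. exp (- x\<^sup>2))"
      by (simp add: set_lebesgue_integral_def)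
    also have "\<dots> = integral {0..b} (\<lambda>x. exp (- x\<^sup>2))"
      by (intro set_borel_integral_eq_integral(2) borel_integrable_atLeastAtMost') (auto intro!: continuous_intros)
    finally show ?case using elim by (simp add: erf_def)
  qed
  ultimately show ?thesis by (rule Lim_transform_eventually)
qed

lemma erf_0: "erf 0 = 0"
  by (simp add: erf_def)

text \<open>Intermediate values between \<open>erf 0 = 0\<close> and the limit 1, and strict
  monotonicity; this makes the description in \<open>mu1\<close> denote an actual solution.\<close>

lemma ex1_erf_eq:
  assumes "0 < A" "A < 1"
  shows "\<exists>!x. 0 < x \<and> erf x = A"
proof -
  have "\<forall>\<^sub>F b in at_top. 0 \<le> b \<and> A < erf b"
    using eventually_ge_at_top[of 0] order_tendstoD(1)[OF erf_at_top assms(2)]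
    by eventually_elim auto
  then obtain b where b: "0 \<le> b" "A < erf b" by (auto simp: eventually_at_top_linorder)
  have "continuous_on {0..b} erf \<longleftrightarrow> continuous_on {0..b} (\<lambda>u. 1 - wright (- (2 * u)) (- (1/2)) 1)"
    by (rule continuous_on_cong) (auto simp: erf_eq_wright)
  also have \<dots>
    using DERIV_continuous[OF DERIV_wright_half] by (simp add: continuous_on_eq_continuous_within)
  finally obtain x where x: "0 \<le> x" "x \<le> b" "erf x = A"
    using IVT'[of erf 0 A b] b assms by (auto simp: erf_0)
  hence "0 < x" using assms by (cases "x = 0") (auto simp: erf_0)
  with x show ?thesis
    by (metis erf_strict_mono less_imp_le linorder_neq_iff)
qed

section \<open>The transcendental equation\<close>

text \<open>The radius \<open>R\<close> is fixed before \<nu>: past \<open>R\<close> the function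
  can drop by at most \<open>C / R\<close>, and \<open>erf (R / 2) - C / R\<close> tends to 1, hence
  exceeds \<open>A\<close> for large \<open>R\<close>.\<close>

lemma eventually_wright_far:
  assumes A: "A < 1"
  shows "\<exists>R>0. \<forall>\<^sub>F \<nu> in at_left (1/2). \<forall>x\<ge>R. A < 1 - wright (- x) (- \<nu>) 1"
proof -
  define h where "h = (\<lambda>\<nu>::real. (1 / \<nu>\<^sup>2 - 1 / \<nu>) * (Gamma (1 - \<nu>) / pi) + 1 / \<nu>\<^sup>2 * (Gamma (2 - \<nu>) / pi))"
  \<comment> \<open>One more than the limit of \<open>h\<close>, so that \<open>h \<nu> < C\<close>
    for all \<nu> close to 1/2.\<close>
  define C where "C = h (1/2) + 1"
  have "isCont h (1/2)" unfolding h_def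
    by (intro continuous_intros) (auto elim!: nonpos_Ints_cases simp: field_simps)
  hence "(h \<longlongrightarrow> h (1/2)) (at_left (1/2))"
    by (simp add: isCont_def filterlim_at_split)
  hence C: "\<forall>\<^sub>F \<nu> in at_left (1/2). h \<nu> < C"
    by (rule order_tendstoD) (simp add: C_def)
  have "filterlim (\<lambda>R::real. R / 2) at_top at_top" by real_asymp
  hence "((\<lambda>R. erf (R / 2)) \<longlongrightarrow> 1) at_top" by (rule filterlim_compose[OF erf_at_top])
  moreover have "((\<lambda>R. C / R) \<longlongrightarrow> 0) at_top" by real_asymp
  ultimately have "((\<lambda>R. erf (R / 2) - C / R) \<longlongrightarrow> 1 - 0) at_top" by (intro tendsto_diff)
  hence "\<forall>\<^sub>F R in at_top. A < erf (R / 2) - C / R"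
    using A by (intro order_tendstoD(1)) auto
  hence "\<forall>\<^sub>F R in at_top. 0 < R \<and> A < erf (R / 2) - C / R"
    using eventually_gt_at_top[of 0] by eventually_elim auto
  then obtain R where R: "0 < R" "A < erf (R / 2) - C / R"
    by (auto simp: eventually_at_top_linorder)
  have "((\<lambda>\<nu>. 1 - wright (- R) (- \<nu>) (1 - real 0 * \<nu>)) \<longlongrightarrow> 1 - wright (- R) (- (1/2)) (1 - real 0 * (1/2))) (at_left (1/2))"
    by (intro tendsto_diff tendsto_const tendsto_wright filterlim_ident)
  hence "((\<lambda>\<nu>. 1 - wright (- R) (- \<nu>) 1) \<longlongrightarrow> erf (R / 2)) (at_left (1/2))"
    using R by (simp add: erf_eq_wright)
  hence FR: "\<forall>\<^sub>F \<nu> in at_left (1/2). A + C / R < 1 - wright (- R) (- \<nu>) 1"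
    using R by (intro order_tendstoD(1)) auto
  have "\<forall>\<^sub>F \<nu> in at_left (1/2). \<nu> \<in> {0<..<1/2::real}"
    by (rule eventually_at_left_real) simp
  with C FR have "\<forall>\<^sub>F \<nu> in at_left (1/2). \<forall>x\<ge>R. A < 1 - wright (- x) (- \<nu>) 1"
  proof eventually_elim
    case (elim \<nu>)
    show ?case
    proof (intro allI impI)
      fix x assume x: "R \<le> x"
      \<comment> \<open>\<open>-C/x\<close> is a primitive of the bound \<open>C/x\<^sup>2\<close> on \<open>|M\<^sub>\<nu>|\<close>\<close>
      have "(1 - wright (- R) (- \<nu>) 1) - C / R \<le> (1 - wright (- x) (- \<nu>) 1) - C / x"
      proof (rule DERIV_nonneg_imp_nondecreasing[OF x])
        fix y assume y: "R \<le> y"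
        hence y0: "y > 0" using R by simp
        have "((\<lambda>y. (1 - wright (- y) (- \<nu>) 1) - C / y) has_real_derivative
            wright (- y) (- \<nu>) (1 - \<nu>) + C / y\<^sup>2) (at y)"
          by (rule derivative_eq_intros DERIV_chain2[OF DERIV_wright] refl
              | use elim y0 in \<open>simp add: power2_eq_square\<close>)+
        moreover have "y\<^sup>2 * \<bar>wright (- y) (- \<nu>) (1 - \<nu>)\<bar> \<le> h \<nu>"
          unfolding h_def by (rule power2_mult_abs_wright_le) (use elim y0 in auto)
        hence "\<bar>wright (- y) (- \<nu>) (1 - \<nu>)\<bar> \<le> C / y\<^sup>2"
          using y0 elim by (simp add: field_simps)
        hence "0 \<le> wright (- y) (- \<nu>) (1 - \<nu>) + C / y\<^sup>2" by linarith
        ultimately show "\<exists>d. ((\<lambda>y. (1 - wright (- y) (- \<nu>) 1) - C / y) has_real_derivative d) (at y) \<and> 0 \<le> d"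
          by blast
      qed
      moreover have "0 \<le> y\<^sup>2 * \<bar>w\<bar>" for y w :: real by simp
      hence "0 \<le> h \<nu>"
        unfolding h_def by (rule order_trans[OF _ power2_mult_abs_wright_le[of \<nu> 1]]) (use elim in auto)
      hence "0 \<le> C / x" using elim x R by auto
      ultimately show "A < 1 - wright (- x) (- \<nu>) 1" using elim by linarith
    qed
  qed
  with R show ?thesis by blast
qed

text \<open>On the interval the limit exp(-x^2/4)/sqrt(\<pi>) is at least its value at
  \<open>R\<close>, and that value is taken as the tolerance in the uniform convergence.\<close>

lemma eventually_wright_pos:
  assumes R: "0 \<le> R"
  shows "\<forall>\<^sub>F \<nu> in at_left (1/2). \<forall>x\<in>{0..R}. 0 < wright (- x) (- \<nu>) (1 - \<nu>)"
proof -
  have "\<forall>\<^sub>F \<nu> in at_left (1/2). \<forall>z\<in>{-R..R}. dist (wright z (- \<nu>) (1 - real 1 * \<nu>))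
      (wright z (- (1/2)) (1 - real 1 * (1/2))) < exp (- R\<^sup>2 / 4) / sqrt pi"
    by (rule uniform_limitD[OF uniform_limit_wright[OF R]]) simp
  thus ?thesis
  proof eventually_elim
    case (elim \<nu>)
    show ?case
    proof
      fix x assume x: "x \<in> {0..R}"
      have "dist (wright (- x) (- \<nu>) (1 - \<nu>)) (exp (- x\<^sup>2 / 4) / sqrt pi) < exp (- R\<^sup>2 / 4) / sqrt pi"
        using elim[rule_format, of "- x"] x wright_half_half[of "- x"] by simp
      moreover have "exp (- R\<^sup>2 / 4) / sqrt pi \<le> exp (- x\<^sup>2 / 4) / sqrt pi"
        using x by (intro divide_right_mono) (auto intro: power_mono)
      ultimately show "0 < wright (- x) (- \<nu>) (1 - \<nu>)" by (simp add: dist_real_def)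
    qed
  qed
qed

text \<open>A sign change near \<open>2 * \<mu>\<close> gives a root, monotonicity on
  \<open>{0..R}\<close> makes it the only one there, and the far estimate excludes roots beyond
  \<open>R\<close>. Hence \<open>THE\<close> picks exactly the root near
  \<open>2 * \<mu>\<close>.\<close>

lemma tendsto_wright_solution:
  assumes a: "(a \<longlongrightarrow> erf \<mu>) (at_left (1/2))" and \<mu>: "0 < \<mu>"
  shows "((\<lambda>\<nu>. THE x. 0 < x \<and> 1 - wright (- x) (- \<nu>) 1 = a \<nu>) \<longlongrightarrow> 2 * \<mu>) (at_left (1/2))"
proof -
  define f where "f = (\<lambda>\<nu> x. 1 - wright (- x) (- \<nu>) 1)"
  have f_lim: "((\<lambda>\<nu>. f \<nu> x) \<longlongrightarrow> erf (x / 2)) (at_left (1/2))" if "0 \<le> x" for x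
  proof -
    have "((\<lambda>\<nu>. 1 - wright (- x) (- \<nu>) (1 - real 0 * \<nu>)) \<longlongrightarrow> 1 - wright (- x) (- (1/2)) (1 - real 0 * (1/2))) (at_left (1/2))"
      by (intro tendsto_diff tendsto_const tendsto_wright filterlim_ident)
    thus ?thesis using that by (simp add: erf_eq_wright f_def)
  qed
  have "erf \<mu> < erf (\<mu> + 1)" using \<mu> by (intro erf_strict_mono) auto
  \<comment> \<open>The limit at infinity gives only \<open>erf (\<mu> + 2) \<le> 1\<close>; one
    more step of strict growth makes the inequality strict, so \<open>erf (\<mu> + 1)\<close> can
    serve as the threshold \<open>A\<close>.\<close>
  moreover have "erf (\<mu> + 1) < 1"
  proof -
    have "erf (\<mu> + 2) \<le> 1"
      by (rule tendsto_lowerbound[OF erf_at_top])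
         (use \<mu> in \<open>auto intro!: eventually_at_top_linorderI[of "\<mu> + 3"] less_imp_le erf_strict_mono\<close>)
    moreover have "erf (\<mu> + 1) < erf (\<mu> + 2)" using \<mu> by (intro erf_strict_mono) auto
    ultimately show ?thesis by simp
  qed
  ultimately obtain A R where A: "erf \<mu> < A" and R: "0 < R"
    and far: "\<forall>\<^sub>F \<nu> in at_left (1/2). \<forall>x\<ge>R. A < f \<nu> x"
    using eventually_wright_far unfolding f_def by blast
  have pos: "\<forall>\<^sub>F \<nu> in at_left (1/2). \<forall>x\<in>{0..R}. 0 < wright (- x) (- \<nu>) (1 - \<nu>)"
    using R by (intro eventually_wright_pos) auto
  have range: "\<forall>\<^sub>F \<nu> in at_left (1/2). \<nu> \<in> {0<..<1/2::real}"
    by (rule eventually_at_left_real) simp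
  show ?thesis
  proof (rule tendstoI)
    fix e' :: real assume "0 < e'"
    \<comment> \<open>The cap \<mu> keeps \<open>2 * \<mu> - e\<close> positive, so the root found
      is admissible.\<close>
    define e where "e = min e' \<mu>"
    have e: "0 < e" "e \<le> e'" "e < 2 * \<mu>" using \<open>0 < e'\<close> \<mu> by (auto simp: e_def)
    have "((\<lambda>\<nu>. f \<nu> (2 * \<mu> - e) - a \<nu>) \<longlongrightarrow> erf ((2 * \<mu> - e) / 2) - erf \<mu>) (at_left (1/2))"
      using e by (intro tendsto_diff f_lim a) auto
    moreover have "erf ((2 * \<mu> - e) / 2) < erf \<mu>" using e by (intro erf_strict_mono) auto
    ultimately have lo: "\<forall>\<^sub>F \<nu> in at_left (1/2). f \<nu> (2 * \<mu> - e) - a \<nu> < 0"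
      by (intro order_tendstoD(2)) auto
    have "((\<lambda>\<nu>. f \<nu> (2 * \<mu> + e) - a \<nu>) \<longlongrightarrow> erf ((2 * \<mu> + e) / 2) - erf \<mu>) (at_left (1/2))"
      using e \<mu> by (intro tendsto_diff f_lim a) auto
    moreover have "erf \<mu> < erf ((2 * \<mu> + e) / 2)" using e \<mu> by (intro erf_strict_mono) auto
    ultimately have hi: "\<forall>\<^sub>F \<nu> in at_left (1/2). 0 < f \<nu> (2 * \<mu> + e) - a \<nu>"
      by (intro order_tendstoD(1)) auto
    have aA: "\<forall>\<^sub>F \<nu> in at_left (1/2). a \<nu> < A" using a A by (rule order_tendstoD)
    show "\<forall>\<^sub>F \<nu> in at_left (1/2). dist (THE x. 0 < x \<and> 1 - wright (- x) (- \<nu>) 1 = a \<nu>) (2 * \<mu>) < e'"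
      using lo hi aA far pos range
    proof eventually_elim
      case (elim \<nu>)
      have deriv: "(f \<nu> has_real_derivative wright (- x) (- \<nu>) (1 - \<nu>)) (at x)" for x
        unfolding f_def
        by (rule derivative_eq_intros DERIV_chain2[OF DERIV_wright] refl | use elim in simp)+
      have incr: "f \<nu> x < f \<nu> y" if "0 \<le> x" "x < y" "y \<le> R" for x y
      proof (rule DERIV_pos_imp_increasing[OF that(2)])
        fix u assume "x \<le> u" "u \<le> y"
        hence "u \<in> {0..R}" using that by auto
        thus "\<exists>d. (f \<nu> has_real_derivative d) (at u) \<and> 0 < d" using deriv elim by blast
      qed
      have "continuous_on {2 * \<mu> - e..2 * \<mu> + e} (f \<nu>)"
        using deriv DERIV_isCont by (blast intro: continuous_at_imp_continuous_on)
      then obtain x where x: "2 * \<mu> - e \<le> x" "x \<le> 2 * \<mu> + e" "f \<nu> x = a \<nu>"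
        using IVT'[of "f \<nu>" "2 * \<mu> - e" "a \<nu>" "2 * \<mu> + e"] elim e by auto
      \<comment> \<open>The sign conditions at the endpoints are strict, so the root lies strictly
        inside and the distance is below \<open>e\<close>.\<close>
      have ne: "x \<noteq> 2 * \<mu> - e" "x \<noteq> 2 * \<mu> + e" using elim x by auto
      have lt: "y < R" if "f \<nu> y = a \<nu>" for y
        using elim(3) elim(4)[rule_format, of y] that by (cases "R \<le> y") auto
      have "(THE x. 0 < x \<and> f \<nu> x = a \<nu>) = x"
      proof (rule the_equality)
        show "0 < x \<and> f \<nu> x = a \<nu>" using x e by auto
        fix y assume y: "0 < y \<and> f \<nu> y = a \<nu>"
        show "y = x"
          using incr[of x y] incr[of y x] lt[of x] lt[of y] x y e by (cases x y rule: linorder_cases) auto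
      qed
      thus ?case using x ne e by (simp add: f_def dist_real_def)
    qed
  qed
qed

section \<open>Passage to the limit in the explicit solution\<close>

theorem theorem5:
  fixes \<rho> k c Tm T0 q0 :: real
  assumes "0 < \<rho>" and "0 < k" and "0 < c" and "Tm < T0" and "0 < q0"
    and "(T0 - Tm) / q0 * sqrt (\<rho> * c * k / pi) < 1"
  shows "((\<lambda>\<alpha>. sqrt (\<rho> * c * k) * (T0 - Tm) / (q0 * Gamma (1 - \<alpha> / 2)))
            \<longlongrightarrow> (T0 - Tm) / q0 * sqrt (\<rho> * c * k / pi)) (at_left 1)
     \<and> ((\<lambda>\<alpha>. ell_frac \<alpha> \<rho> k c Tm T0 q0) \<longlongrightarrow> ell_classical \<rho> k c Tm T0 q0) (at_left 1)
     \<and> (\<forall>t>0. ((\<lambda>\<alpha>. s_frac \<alpha> \<rho> k c Tm T0 q0 t) \<longlongrightarrow> s_classical \<rho> k c Tm T0 q0 t) (at_left 1))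
     \<and> (\<forall>x\<ge>0. \<forall>t>0.
           ((\<lambda>\<alpha>. T_frac \<alpha> \<rho> k c Tm T0 q0 x t) \<longlongrightarrow> T_classical \<rho> k c Tm T0 q0 x t) (at_left 1))"
proof -
  define A where "A = (T0 - Tm) / q0 * sqrt (\<rho> * c * k / pi)"
  define \<mu> where "\<mu> = mu1 \<rho> k c Tm T0 q0"
  define a where "a = (\<lambda>\<nu>. sqrt (\<rho> * c * k) * (T0 - Tm) / (q0 * Gamma (1 - \<nu>)))"
  define \<xi> where "\<xi> = (\<lambda>\<alpha>. xi_frac \<alpha> \<rho> k c Tm T0 q0)"
  have "0 < A" using assms by (simp add: A_def)
  hence "\<exists>!x. 0 < x \<and> erf x = A" using assms by (intro ex1_erf_eq) (simp_all add: A_def)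
  from theI'[OF this] have \<mu>: "0 < \<mu>" "erf \<mu> = A" by (simp_all add: \<mu>_def mu1_def A_def)
  \<comment> \<open>Carries limits in \<nu> = \<alpha>/2 over to limits in \<alpha>, with the
    approach from below preserved.\<close>
  have half: "filterlim (\<lambda>\<alpha>::real. \<alpha> / 2) (at_left (1/2)) (at_left 1)" by real_asymp
  have id: "((\<lambda>\<alpha>::real. \<alpha>) \<longlongrightarrow> 1) (at_left 1)" by (rule tendsto_ident_at)
  have "isCont (\<lambda>\<nu>::real. Gamma (1 - \<nu>)) (1/2)"
    by (intro continuous_intros) (auto elim!: nonpos_Ints_cases simp: field_simps)
  hence "((\<lambda>\<nu>::real. Gamma (1 - \<nu>)) \<longlongrightarrow> sqrt pi) (at_left (1/2))"
    by (simp add: isCont_def filterlim_at_split Gamma_one_half_real)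
  note G1 = this filterlim_compose[OF this half]
  have "isCont (\<lambda>\<nu>::real. Gamma (1 + \<nu>)) (1/2)"
    by (intro continuous_intros) (auto elim!: nonpos_Ints_cases simp: field_simps)
  moreover have "Gamma (3/2 :: real) = sqrt pi / 2"
  proof -
    have "(1/2 :: real) \<notin> \<int>\<^sub>\<le>\<^sub>0" by (auto dest: nonpos_Ints_nonpos)
    thus ?thesis using Gamma_plus1[of "1/2::real"] by (simp add: Gamma_one_half_real add.commute)
  qed
  ultimately have "((\<lambda>\<nu>::real. Gamma (1 + \<nu>)) \<longlongrightarrow> sqrt pi / 2) (at_left (1/2))"
    by (simp add: isCont_def filterlim_at_split)
  note G2 = filterlim_compose[OF this half]
  have "(a \<longlongrightarrow> sqrt (\<rho> * c * k) * (T0 - Tm) / (q0 * sqrt pi)) (at_left (1/2))"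
    unfolding a_def using assms by (intro tendsto_intros G1) auto
  also have "sqrt (\<rho> * c * k) * (T0 - Tm) / (q0 * sqrt pi) = A"
    by (simp add: A_def real_sqrt_divide)
  finally have a_lim: "(a \<longlongrightarrow> A) (at_left (1/2))" .
  have lam: "0 < lam \<rho> k c" using assms by (simp add: lam_def)
  have "((\<lambda>\<nu>. THE x. 0 < x \<and> 1 - wright (- x) (- \<nu>) 1 = a \<nu>) \<longlongrightarrow> 2 * \<mu>) (at_left (1/2))"
    by (rule tendsto_wright_solution) (use a_lim \<mu> in auto)
  from filterlim_compose[OF this half] have \<xi>: "(\<xi> \<longlongrightarrow> 2 * \<mu>) (at_left 1)"
    by (simp add: \<xi>_def xi_frac_def a_def)
  \<comment> \<open>Used twice: with the root \<xi> as argument, and with the similarity variable of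
    the temperature, which itself depends on \<alpha>.\<close>
  have wr: "((\<lambda>\<alpha>. 1 - wright (- z \<alpha>) (- \<alpha> / 2) 1) \<longlongrightarrow> erf (z0 / 2)) (at_left 1)"
    if "(z \<longlongrightarrow> z0) (at_left 1)" "0 \<le> z0" for z z0
  proof -
    have "((\<lambda>\<alpha>. 1 - wright (- z \<alpha>) (- (\<alpha> / 2)) (1 - real 0 * (\<alpha> / 2))) \<longlongrightarrow>
        1 - wright (- z0) (- (1/2)) (1 - real 0 * (1/2))) (at_left 1)"
      by (intro tendsto_diff tendsto_const tendsto_wright half tendsto_minus that)
    thus ?thesis using that by (simp add: erf_eq_wright)
  qed
  have W: "((\<lambda>\<alpha>. 1 - wright (- \<xi> \<alpha>) (- \<alpha> / 2) 1) \<longlongrightarrow> A) (at_left 1)"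
    using wr[OF \<xi>] \<mu> by simp
  have "((\<lambda>\<alpha>. wright (- \<xi> \<alpha>) (- (\<alpha> / 2)) (1 - real 1 * (\<alpha> / 2))) \<longlongrightarrow>
      wright (- (2 * \<mu>)) (- (1/2)) (1 - real 1 * (1/2))) (at_left 1)"
    by (intro tendsto_wright half tendsto_minus \<xi>)
  hence M: "((\<lambda>\<alpha>. mainardi (\<alpha> / 2) (\<xi> \<alpha>)) \<longlongrightarrow> exp (- \<mu>\<^sup>2) / sqrt pi) (at_left 1)"
    by (simp add: mainardi_def wright_half_half power_mult_distrib)

  have "((\<lambda>\<alpha>. a (\<alpha> / 2)) \<longlongrightarrow> A) (at_left 1)" by (rule filterlim_compose[OF a_lim half])
  moreover have "((\<lambda>\<alpha>. ell_frac \<alpha> \<rho> k c Tm T0 q0) \<longlongrightarrow> ell_classical \<rho> k c Tm T0 q0) (at_left 1)"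
  proof -
    have "((\<lambda>\<alpha>. c * (T0 - Tm) * Gamma (1 - \<alpha> / 2) / Gamma (1 + \<alpha> / 2) *
        (mainardi (\<alpha> / 2) (\<xi> \<alpha>) / (\<xi> \<alpha> * (1 - wright (- \<xi> \<alpha>) (- \<alpha> / 2) 1)))) \<longlongrightarrow>
        c * (T0 - Tm) * sqrt pi / (sqrt pi / 2) * (exp (- \<mu>\<^sup>2) / sqrt pi / (2 * \<mu> * A))) (at_left 1)"
      using \<mu> \<open>0 < A\<close> by (intro tendsto_mult tendsto_divide tendsto_const G1 G2 M W \<xi>) auto
    also have "c * (T0 - Tm) * sqrt pi / (sqrt pi / 2) * (exp (- \<mu>\<^sup>2) / sqrt pi / (2 * \<mu> * A)) =
        c * (T0 - Tm) / (sqrt pi * A) * exp (- \<mu>\<^sup>2) / \<mu>"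
      using \<mu> \<open>0 < A\<close> by (simp add: field_simps)
    also have "c * (T0 - Tm) / (sqrt pi * A) = q0 * sqrt (c / (\<rho> * k))"
    proof -
      have "sqrt pi * A = (T0 - Tm) / q0 * (sqrt c * sqrt (\<rho> * k))"
        by (simp add: A_def real_sqrt_divide real_sqrt_mult)
      hence eq: "c * (T0 - Tm) / (sqrt pi * A) =
          sqrt c * sqrt c * (T0 - Tm) / ((T0 - Tm) / q0 * (sqrt c * sqrt (\<rho> * k)))"
        using assms by simp
      \<comment> \<open>With \<open>p\<close> for \<open>sqrt c\<close> and \<open>r\<close> for
        \<open>sqrt (\<rho> * k)\<close> the identity becomes rational, which spares
        \<open>field_simps\<close> the square roots.\<close>
      have cancel: "p * p * d / (d / q0 * (p * r)) = q0 * (p / r)" if "0 < p" "0 < r" "0 < d" for p r d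
        using that \<open>0 < q0\<close> by (simp add: field_simps)
      show ?thesis unfolding eq real_sqrt_divide by (rule cancel) (use assms in auto)
    qed
    finally show ?thesis by (simp add: ell_frac_def ell_classical_def Let_def \<xi>_def \<mu>_def)
  qed
  moreover have "((\<lambda>\<alpha>. s_frac \<alpha> \<rho> k c Tm T0 q0 t) \<longlongrightarrow> s_classical \<rho> k c Tm T0 q0 t) (at_left 1)" if "0 < t" for t
  proof -
    have "((\<lambda>\<alpha>. lam \<rho> k c * \<xi> \<alpha> * t powr (\<alpha> / 2)) \<longlongrightarrow> lam \<rho> k c * (2 * \<mu>) * t powr (1 / 2)) (at_left 1)"
      using that by (intro tendsto_intros \<xi> id) auto
    thus ?thesis using that by (simp add: s_frac_def s_classical_def \<xi>_def \<mu>_def powr_half_sqrt mult_ac)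
  qed
  moreover have "((\<lambda>\<alpha>. T_frac \<alpha> \<rho> k c Tm T0 q0 x t) \<longlongrightarrow> T_classical \<rho> k c Tm T0 q0 x t) (at_left 1)"
    if "0 \<le> x" "0 < t" for x t
  proof -
    have "((\<lambda>\<alpha>. x / (lam \<rho> k c * t powr (\<alpha> / 2))) \<longlongrightarrow> x / (lam \<rho> k c * t powr (1 / 2))) (at_left 1)"
      using that lam by (intro tendsto_intros id) auto
    from wr[OF this] have "((\<lambda>\<alpha>. T0 - (T0 - Tm) / (1 - wright (- \<xi> \<alpha>) (- \<alpha> / 2) 1) *
        (1 - wright (- (x / (lam \<rho> k c * t powr (\<alpha> / 2)))) (- \<alpha> / 2) 1)) \<longlongrightarrow>
        T0 - (T0 - Tm) / A * erf (x / (lam \<rho> k c * t powr (1 / 2)) / 2)) (at_left 1)"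
      using that lam \<open>0 < A\<close> by (intro tendsto_diff tendsto_mult tendsto_divide tendsto_const W) auto
    also have "(T0 - Tm) / A = q0 * sqrt (pi / (\<rho> * c * k))"
      using assms by (simp add: A_def real_sqrt_divide)
    also have "x / (lam \<rho> k c * t powr (1 / 2)) / 2 = x / (2 * lam \<rho> k c * sqrt t)"
      using that by (simp add: powr_half_sqrt mult_ac)
    finally show ?thesis by (simp add: T_frac_def T_classical_def Let_def \<xi>_def)
  qed
  ultimately show ?thesis unfolding a_def A_def by blast
qed

end
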